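(* For every permutation $\pi\in S_n$ with $\pi\neq id_n$, there exists a child $\tau$ of $id_n$ in $T_n$ such that $T(\pi)$ and $T(\tau)$ are isomorphic (as rooted trees).
   Context: $S_n$ is the set of permutations $\pi=\pi_1\dots\pi_n$ of $\{1,\dots,n\}$ and $id_n=12\dots n$. An element $\pi_j$ is a left-to-right maximum of $\pi$ if $\pi_j>\pi_i$ for all $i<j$. The bubblesort operator $\mathbf{B}$ is one pass of the bubblesort algorithm: scan the positions from left to right, each time exchanging the current element with the one to its right whenever the latter is smaller. Equivalently, writing $\pi=\mu_1A_1\mu_2A_2\dots\mu_kA_k$ where the $\mu_i$ are all the left-to-right maxima of $\pi$ (and the $A_i$ are possibly empty sequences), $\mathbf{B}(\pi)=A_1\mu_1A_2\mu_2\dots A_k\mu_k$. $T_n$ is the rooted tree whose nodes are the permutations in $S_n$, with root $id_n$, in which $\tau$ is a child of $\sigma$ if and only if $\mathbf{B}(\tau)=\sigma$ and $\sigma\ne\tau$. For $\pi\in S_n$, $T(\pi)$ is the subtree of $T_n$ rooted at $\pi$ (consisting of $\pi$ and all its descendants). *)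

theory Defs
  imports Main "HOL-Combinatorics.Multiset_Permutations"
begin

text \<open>Permutations are in one-line notation; the elements of
  \<open>permutations_of_set {1..n}\<close> are the lists that contain each of 1, ..., n exactly once.\<close>

abbreviation S :: "nat \<Rightarrow> nat list set" where
  "S n \<equiv> permutations_of_set {1..n}"

definition id_perm :: "nat \<Rightarrow> nat list" where
  "id_perm n = [1..<Suc n]"

text \<open>One pass of bubblesort; the head of the argument is the element at the
  current position of the scan.\<close>

fun bubblesort_pass :: "'a::linorder list \<Rightarrow> 'a list" where
  "bubblesort_pass (x # y # zs) =
     (if y < x then y # bubblesort_pass (x # zs) else x # bubblesort_pass (y # zs))"
| "bubblesort_pass zs = zs"

text \<open>A rooted tree is given by its nodes, its root and its parent-child pairs
  \<open>(parent, child)\<close>. The type does not enforce the tree axioms.\<close>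

record 'a rooted_tree =
  nodes :: "'a set"
  root :: 'a
  edges :: "('a \<times> 'a) set"

definition is_child :: "'a rooted_tree \<Rightarrow> 'a \<Rightarrow> 'a \<Rightarrow> bool" where
  "is_child T y x \<longleftrightarrow> (x, y) \<in> edges T"

definition subtree :: "'a rooted_tree \<Rightarrow> 'a \<Rightarrow> 'a rooted_tree" where
  "subtree T x =
     (let V = {y \<in> nodes T. (x, y) \<in> (edges T)\<^sup>*}
      in \<lparr>nodes = V, root = x, edges = edges T \<inter> V \<times> V\<rparr>)"

definition rooted_tree_isomorphic :: "'a rooted_tree \<Rightarrow> 'b rooted_tree \<Rightarrow> bool" where
  "rooted_tree_isomorphic T U \<longleftrightarrow>
     (\<exists>f. bij_betw f (nodes T) (nodes U) \<and> f (root T) = root U \<and>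
          (\<forall>x\<in>nodes T. \<forall>y\<in>nodes T. (x, y) \<in> edges T \<longleftrightarrow> (f x, f y) \<in> edges U))"

definition bubblesort_tree :: "nat \<Rightarrow> nat list rooted_tree" where
  "bubblesort_tree n =
     \<lparr>nodes = S n, root = id_perm n,
      edges = {(\<sigma>, \<tau>). \<sigma> \<in> S n \<and> \<tau> \<in> S n \<and> bubblesort_pass \<tau> = \<sigma> \<and> \<sigma> \<noteq> \<tau>}\<rparr>"

end

theory Submission
  imports Defs
begin

text \<open>The subtree below a permutation other than the identity depends only on the positions of its
  left-to-right maxima. If the last entry of \<open>\<pi>\<close> is not its maximum, \<open>\<pi>\<close> has no preimage under
  bubblesort. Otherwise a preimage arises by choosing a set of left-to-right maxima of \<open>\<pi>\<close> that
  contains the last one, and moving each chosen entry to the front of the block that it ends; the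
  chosen entries are then the left-to-right maxima of the preimage, at positions determined by
  those chosen in \<open>\<pi>\<close>. So permutations with left-to-right maxima at the same positions have
  children that correspond in the same way, and so on down the tree. Finally every set of
  positions that contains the first one is realised by a preimage of the identity.\<close>

section \<open>Trees given by a labelled parent map\<close>

text \<open>\<open>child_lift\<close> matches the children of equally labelled nodes one to one and
  preserves labels, so the matching can be repeated level by level.\<close>

locale labelled_parent_map =
  fixes N :: "'a set" and p :: "'a \<Rightarrow> 'a" and r :: 'a and label :: "'a \<Rightarrow> 'b"
  assumes p_in: "z \<in> N \<Longrightarrow> p z \<in> N"
    and p_root: "p r = r"
    and reaches_root: "z \<in> N \<Longrightarrow> \<exists>d. (p ^^ d) z = r"
    and child_lift: "\<lbrakk>x \<in> N; y \<in> N; x \<noteq> r; y \<noteq> r; label x = label y; u \<in> N; p u = x\<rbrakk>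
      \<Longrightarrow> \<exists>!v. v \<in> N \<and> p v = y \<and> label v = label u"
begin

section \<open>Iterated parents and depth\<close>

lemma funpow_p_in: "z \<in> N \<Longrightarrow> (p ^^ d) z \<in> N"
  by (induction d) (auto intro: p_in)

lemma funpow_p_root: "(p ^^ d) r = r"
  by (induction d) (auto simp: p_root)

lemma no_cycle:
  assumes "z \<in> N" "(p ^^ k) z = z" "k > 0"
  shows "z = r"
proof -
  obtain d where d: "(p ^^ d) z = r" using reaches_root assms(1) by blast
  have "(p ^^ (m * k)) z = z" for m
    by (induction m) (auto simp: funpow_add assms(2))
  \<comment> \<open>\<open>d\<close> rounds of the cycle take at least \<open>d\<close> steps; after
    \<open>d\<close> of them the iterate is \<open>r\<close> and stays there.\<close>
  moreover have "d * k = (d * k - d) + d" using assms(3) by simp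
  ultimately have "(p ^^ ((d * k - d) + d)) z = z" by metis
  then show ?thesis by (simp only: funpow_add o_apply d funpow_p_root)
qed

text \<open>Two different depths below \<open>x\<close> would close a cycle through
  \<open>x\<close>.\<close>

lemma depth_unique:
  assumes "z \<in> N" "x \<noteq> r" "(p ^^ d) z = x" "(p ^^ e) z = x"
  shows "d = e"
proof -
  have le: "e \<le> d" if "(p ^^ d) z = x" "(p ^^ e) z = x" for d e
  proof (rule ccontr)
    assume "\<not> e \<le> d"
    then have "e = (e - d) + d" and pos: "e - d > 0" by auto
    with that have "(p ^^ (e - d)) x = x" by (metis funpow_add o_apply)
    moreover have "x \<in> N" using funpow_p_in assms(1) that by blast
    ultimately show False using no_cycle pos assms(2) by blast
  qed
  show ?thesis using le[OF assms(3,4)] le[OF assms(4,3)] by simp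
qed

text \<open>Climbs \<open>d\<close> steps from \<open>z\<close>, then descends from
  \<open>y\<close>, choosing at each level the child with the label met on the way up.\<close>

primrec transport :: "nat \<Rightarrow> 'a \<Rightarrow> 'a \<Rightarrow> 'a" where
  "transport 0 y z = y"
| "transport (Suc d) y z = (THE v. v \<in> N \<and> p v = transport d y (p z) \<and> label v = label z)"

text \<open>Each level of the descent needs membership and label from the level above, hence the
  joint induction. For \<open>d = 0\<close> the last clause would make \<open>y\<close> a fixed
  point of \<open>p\<close>.\<close>

lemma transport:
  assumes "x \<in> N" "y \<in> N" "x \<noteq> r" "y \<noteq> r" "label x = label y"
    and "z \<in> N" "(p ^^ d) z = x"
  shows "transport d y z \<in> N \<and> (p ^^ d) (transport d y z) = y \<and>
    label (transport d y z) = label z \<and> transport d x (transport d y z) = z \<and>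
    (d > 0 \<longrightarrow> p (transport d y z) = transport (d - 1) y (p z))"
  using assms(6,7)
proof (induction d arbitrary: z)
  case 0
  then show ?case using assms by simp
next
  case (Suc d)
  have pz: "p z \<in> N" "(p ^^ d) (p z) = x"
    using Suc.prems p_in by (auto simp: funpow_swap1)
  define w where "w = transport d y (p z)"
  have w: "w \<in> N" "(p ^^ d) w = y" "label w = label (p z)" "transport d x w = p z"
    using Suc.IH[OF pz] by (auto simp: w_def)
  have nr: "p z \<noteq> r" "w \<noteq> r" using pz w assms(3,4) funpow_p_root by auto
  define v where "v = transport (Suc d) y z"
  have v: "v \<in> N \<and> p v = w \<and> label v = label z"
    unfolding v_def transport.simps w_def[symmetric]
    by (rule theI', rule child_lift) (use pz w nr Suc.prems in auto)
  \<comment> \<open>Lifting back from \<open>w\<close> to \<open>p z\<close>: the unique child found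
    there must be \<open>z\<close>.\<close>
  have "\<exists>!u. u \<in> N \<and> p u = p z \<and> label u = label v"
    by (rule child_lift[of w]) (use pz w nr v in auto)
  then have "transport (Suc d) x v = z"
    using v Suc.prems w by (auto intro!: the1_equality)
  moreover have "(p ^^ Suc d) v = y" using v w by (simp add: funpow_swap1)
  ultimately show ?case using v unfolding v_def[symmetric] by (simp add: w_def)
qed

section \<open>The tree and its subtrees\<close>

definition tree :: "'a rooted_tree" where
  "tree = \<lparr>nodes = N, root = r, edges = {(x, y). x \<in> N \<and> y \<in> N \<and> p y = x \<and> x \<noteq> y}\<rparr>"

definition descendants :: "'a \<Rightarrow> 'a set" where
  "descendants x = {z \<in> N. \<exists>d. (p ^^ d) z = x}"

lemma rtrancl_edges_iff:
  assumes "z \<in> N"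
  shows "(x, z) \<in> (edges tree)\<^sup>* \<longleftrightarrow> (\<exists>d. (p ^^ d) z = x)"
proof
  assume "(x, z) \<in> (edges tree)\<^sup>*"
  then show "\<exists>d. (p ^^ d) z = x"
  proof (induction rule: rtrancl_induct)
    case base
    have "(p ^^ 0) x = x" by simp
    then show ?case by blast
  next
    case (step y z)
    then obtain d where "(p ^^ d) (p z) = x" by (auto simp: tree_def)
    then have "(p ^^ Suc d) z = x" by (simp add: funpow_swap1)
    then show ?case by blast
  qed
next
  have "(p ^^ d) z = x \<Longrightarrow> (x, z) \<in> (edges tree)\<^sup>*" for d
    using assms
  proof (induction d arbitrary: z)
    case (Suc d)
    then have "(x, p z) \<in> (edges tree)\<^sup>*" by (auto simp: funpow_swap1 p_in)
    \<comment> \<open>The root is its own parent but carries no loop in \<open>edges tree\<close>,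
      so a step of \<open>p\<close> may be empty.\<close>
    moreover have "p z = z \<or> (p z, z) \<in> edges tree"
      using Suc.prems p_in by (auto simp: tree_def)
    ultimately show ?case by (metis rtrancl.rtrancl_into_rtrancl)
  qed simp
  then show "\<exists>d. (p ^^ d) z = x \<Longrightarrow> (x, z) \<in> (edges tree)\<^sup>*" by blast
qed

lemma nodes_subtree: "nodes (subtree tree x) = descendants x"
  using rtrancl_edges_iff
  by (auto simp: subtree_def descendants_def Let_def tree_def)

text \<open>Below a node other than the root \<open>p\<close> has no fixed points, so the exclusion
  of loops in \<open>tree\<close> holds automatically.\<close>

lemma edges_subtree_iff:
  assumes "x \<noteq> r" "u \<in> descendants x" "v \<in> descendants x"
  shows "(u, v) \<in> edges (subtree tree x) \<longleftrightarrow> p v = u"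
proof -
  have "p v \<noteq> v"
  proof
    assume "p v = v"
    then have "v = r" using no_cycle[of v 1] assms by (auto simp: descendants_def)
    then show False using assms funpow_p_root by (auto simp: descendants_def)
  qed
  moreover have "edges (subtree tree x) = edges tree \<inter> descendants x \<times> descendants x"
    using nodes_subtree[of x] by (simp add: subtree_def Let_def)
  ultimately show ?thesis
    using assms by (auto simp: tree_def descendants_def)
qed

text \<open>For \<open>x \<noteq> r\<close> at most one \<open>d\<close> qualifies, by
  \<open>depth_unique\<close>; \<open>LEAST\<close> merely names it.\<close>

definition depth :: "'a \<Rightarrow> 'a \<Rightarrow> nat" where
  "depth x z = (LEAST d. (p ^^ d) z = x)"

lemma depth_eqI:
  assumes "z \<in> N" "x \<noteq> r" "(p ^^ d) z = x"
  shows "depth x z = d"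
  unfolding depth_def
  by (rule Least_equality) (use assms depth_unique in blast)+

text \<open>Transport preserves depth, so the way back uses the same number of steps, and the parent
  uses one step less.\<close>

lemma descendants_transport:
  assumes "x \<in> N" "y \<in> N" "x \<noteq> r" "y \<noteq> r" "label x = label y" "z \<in> descendants x"
  shows "transport (depth x z) y z \<in> descendants y"
    and "transport (depth y (transport (depth x z) y z)) x (transport (depth x z) y z) = z"
    and "p z \<in> descendants x \<Longrightarrow>
      p (transport (depth x z) y z) = transport (depth x (p z)) y (p z)"
proof -
  obtain d where d: "z \<in> N" "(p ^^ d) z = x" using assms by (auto simp: descendants_def)
  have dep: "depth x z = d" using depth_eqI d assms by blast
  note t = transport[OF assms(1-5) d]
  have "depth y (transport d y z) = d" by (rule depth_eqI) (use t assms in auto)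
  then show "transport (depth x z) y z \<in> descendants y"
    "transport (depth y (transport (depth x z) y z)) x (transport (depth x z) y z) = z"
    using t by (auto simp: dep descendants_def)
  assume "p z \<in> descendants x"
  then obtain e where e: "p z \<in> N" "(p ^^ e) (p z) = x" by (auto simp: descendants_def)
  then have "(p ^^ Suc e) z = x" by (simp add: funpow_swap1)
  then have "d = Suc e" using depth_unique d assms by blast
  moreover have "depth x (p z) = e" using depth_eqI e assms by blast
  ultimately show "p (transport (depth x z) y z) = transport (depth x (p z)) y (p z)"
    using t dep by auto
qed

theorem subtrees_isomorphic:
  assumes "x \<in> N" "y \<in> N" "x \<noteq> r" "y \<noteq> r" "label x = label y"
  shows "rooted_tree_isomorphic (subtree tree x) (subtree tree y)"
proof -
  define f where "f z = transport (depth x z) y z" for z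
  define g where "g z = transport (depth y z) x z" for z
  note xy = descendants_transport[OF assms, folded f_def g_def]
  note yx = descendants_transport[OF assms(2,1,4,3) assms(5)[symmetric], folded f_def g_def]
  have "bij_betw f (descendants x) (descendants y)"
    by (rule bij_betw_byWitness[where f' = g]) (use xy yx in auto)
  moreover have "f x = y"
    using depth_eqI[of x x 0] assms by (simp add: f_def)
  \<comment> \<open>The converse direction is the compatibility of the inverse \<open>g\<close> with
    parents.\<close>
  moreover have "p v = u \<longleftrightarrow> p (f v) = f u"
    if "u \<in> descendants x" "v \<in> descendants x" for u v
    using xy yx that by metis
  ultimately show ?thesis
    unfolding rooted_tree_isomorphic_def nodes_subtree
    using xy(1) assms edges_subtree_iff
    by (intro exI[of _ f]) (auto simp: subtree_def Let_def)
qed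

end

section \<open>Left-to-right maxima and bubblesort\<close>

definition lr_maxima :: "'a::linorder list \<Rightarrow> nat set" where
  "lr_maxima xs = {j. j < length xs \<and> (\<forall>i<j. xs ! i < xs ! j)}"

lemma lr_maxima_Cons_Suc_iff:
  "Suc j \<in> lr_maxima (x # xs) \<longleftrightarrow> j \<in> lr_maxima xs \<and> x < xs ! j"
  by (auto simp: lr_maxima_def less_Suc_eq_0_disj)

lemma zero_in_lr_maxima_iff: "0 \<in> lr_maxima xs \<longleftrightarrow> xs \<noteq> []"
  by (auto simp: lr_maxima_def)

text \<open>Whatever exceeds \<open>y\<close> also exceeds \<open>x\<close>.\<close>

lemma lr_maxima_less: "x < y \<Longrightarrow> Suc j \<in> lr_maxima (x # y # ys) \<longleftrightarrow> j \<in> lr_maxima (y # ys)"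
  by (cases j) (auto simp: lr_maxima_Cons_Suc_iff zero_in_lr_maxima_iff)

text \<open>Behind a larger \<open>x\<close>, the entry \<open>y\<close> sets no new maximum and
  hides no later one.\<close>

lemma lr_maxima_greater:
  assumes "y < x"
  shows "Suc 0 \<notin> lr_maxima (x # y # ys)"
    and "Suc (Suc j) \<in> lr_maxima (x # y # ys) \<longleftrightarrow> Suc j \<in> lr_maxima (x # ys)"
  using assms by (auto simp: lr_maxima_Cons_Suc_iff)

section \<open>Bubblesort passes and their preimages\<close>

lemma mset_bubblesort_pass: "mset (bubblesort_pass xs) = mset xs"
  by (induction xs rule: bubblesort_pass.induct) auto

lemma length_bubblesort_pass: "length (bubblesort_pass xs) = length xs"
  by (metis mset_bubblesort_pass size_mset)

lemma bubblesort_pass_in_S_iff: "bubblesort_pass xs \<in> S n \<longleftrightarrow> xs \<in> S n"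
  unfolding permutations_of_set_def
  by (simp add: mset_eq_imp_distinct_iff[OF mset_bubblesort_pass]
      mset_eq_setD[OF mset_bubblesort_pass])

text \<open>The bound by the head makes the induction work.\<close>

lemma lr_maxima_bubblesort_pass_Cons:
  assumes "distinct (x # ys)" and "j = length ys \<or> Suc j \<in> lr_maxima (x # ys)"
  shows "j \<in> lr_maxima (bubblesort_pass (x # ys)) \<and> x \<le> bubblesort_pass (x # ys) ! j"
  using assms
proof (induction ys arbitrary: x j)
  case Nil
  then show ?case by (auto simp: lr_maxima_def)
next
  case (Cons y ys)
  show ?case
  proof (cases "y < x")
    case True
    then obtain i where i: "j = Suc i" using Cons.prems lr_maxima_greater(1)[OF True, of ys]
      by (cases j) auto
    then have "i \<in> lr_maxima (bubblesort_pass (x # ys)) \<and> x \<le> bubblesort_pass (x # ys) ! i"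
      using Cons.IH[of x i] Cons.prems True by (auto simp: lr_maxima_greater(2))
    then show ?thesis using True i by (auto simp: lr_maxima_Cons_Suc_iff)
  next
    case False
    then have xy: "x < y" using Cons.prems by auto
    show ?thesis
    proof (cases j)
      case 0
      then show ?thesis using False by (auto simp: zero_in_lr_maxima_iff)
    next
      case (Suc i)
      then have "i \<in> lr_maxima (bubblesort_pass (y # ys)) \<and> y \<le> bubblesort_pass (y # ys) ! i"
        using Cons.IH[of y i] Cons.prems xy by (auto simp: lr_maxima_less)
      then show ?thesis using False Suc xy by (auto simp: lr_maxima_Cons_Suc_iff)
    qed
  qed
qed

text \<open>On meeting a left-to-right maximum at \<open>Suc j\<close>, the scan drops the previous
  one at \<open>j\<close>. At the end of the list it drops the overall maximum.\<close>

lemma lr_maxima_bubblesort_pass: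
  assumes "distinct xs" "Suc j = length xs \<or> Suc j \<in> lr_maxima xs"
  shows "j \<in> lr_maxima (bubblesort_pass xs)"
  using assms lr_maxima_bubblesort_pass_Cons[of "hd xs" "tl xs" j]
  by (cases xs) (auto simp: lr_maxima_def)

text \<open>The positions of the left-to-right maxima determine the outcome of every comparison in
  the scan, so the pass can be undone.\<close>

lemma bubblesort_pass_Cons_eqD:
  assumes "length xs = length ys" "distinct (x # xs)" "distinct (y # ys)"
    and "bubblesort_pass (x # xs) = bubblesort_pass (y # ys)"
    and "\<And>j. Suc j \<in> lr_maxima (x # xs) \<longleftrightarrow> Suc j \<in> lr_maxima (y # ys)"
  shows "x # xs = y # ys"
  using assms
proof (induction xs ys arbitrary: x y rule: list_induct2)
  case Nil
  then show ?case by simp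
next
  case (Cons x' xs y' ys)
  have iff: "x < x' \<longleftrightarrow> y < y'"
    using Cons.prems(4)[of 0] by (simp add: lr_maxima_Cons_Suc_iff zero_in_lr_maxima_iff)
  show ?case
  proof (cases "x < x'")
    case True
    then have lt: "x < x'" "y < y'" "\<not> x' < x" "\<not> y' < y" using iff by auto
    then have "Suc j \<in> lr_maxima (x' # xs) \<longleftrightarrow> Suc j \<in> lr_maxima (y' # ys)" for j
      using Cons.prems(4)[of "Suc j"] by (simp add: lr_maxima_less)
    then have "x' # xs = y' # ys"
      using Cons.prems(1-3) lt by (intro Cons.IH) auto
    then show ?thesis using Cons.prems(3) lt by auto
  next
    case False
    then have gt: "x' < x" "y' < y" using iff Cons.prems(1,2) by auto
    then have "Suc j \<in> lr_maxima (x # xs) \<longleftrightarrow> Suc j \<in> lr_maxima (y # ys)" for j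
      using Cons.prems(4)[of "Suc j"] by (simp add: lr_maxima_greater(2))
    then have "x # xs = y # ys"
      using Cons.prems(1-3) gt by (intro Cons.IH) auto
    then show ?thesis using Cons.prems(3) gt by auto
  qed
qed

lemma bubblesort_pass_eqD:
  assumes "bubblesort_pass xs = bubblesort_pass ys" "lr_maxima xs = lr_maxima ys"
    and "distinct xs" "distinct ys"
  shows "xs = ys"
proof -
  have len: "length xs = length ys" using assms(1) length_bubblesort_pass by metis
  show ?thesis
  proof (cases xs)
    case Nil
    then show ?thesis using len by simp
  next
    case (Cons x xs')
    then obtain y ys' where "ys = y # ys'" using len by (cases ys) auto
    then show ?thesis using bubblesort_pass_Cons_eqD[of xs' ys' x y] assms len Cons by simp
  qed
qed

text \<open>\<open>insert m M\<close> holds the chosen positions; a block ending at \<open>j\<close>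
  makes the next one start at \<open>Suc j\<close>. The preimage is built from the right, and the
  last clause, on its head, drives the induction.\<close>

lemma bubblesort_pass_preimage_exists:
  assumes "distinct zs" "length zs = Suc m" "m \<in> lr_maxima zs" "M \<subseteq> lr_maxima zs" "M \<subseteq> {..<m}"
  shows "\<exists>x xs. bubblesort_pass (x # xs) = zs \<and>
    (\<forall>j. Suc j \<in> lr_maxima (x # xs) \<longleftrightarrow> j \<in> M) \<and> (\<exists>j\<in>insert m M. x = zs ! j)"
  using assms
proof (induction m arbitrary: zs M)
  case 0
  then obtain z where z: "zs = [z]" by (auto simp: length_Suc_conv)
  have "bubblesort_pass [z] = zs" "\<forall>j. Suc j \<in> lr_maxima [z] \<longleftrightarrow> j \<in> M" "z = zs ! 0"
    using z 0 by (auto simp: lr_maxima_def)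
  then show ?case by blast
next
  case (Suc m)
  then obtain z zs' where zs: "zs = z # zs'" "length zs' = Suc m" by (auto simp: length_Suc_conv)
  define M' where "M' = {j. Suc j \<in> M}"
  have sub: "j \<in> lr_maxima zs'" "z < zs' ! j" if "j \<in> insert m M'" for j
    using Suc.prems(3,4) that zs(1) lr_maxima_Cons_Suc_iff[of j z zs'] by (auto simp: M'_def)
  have "\<exists>x xs. bubblesort_pass (x # xs) = zs' \<and>
    (\<forall>j. Suc j \<in> lr_maxima (x # xs) \<longleftrightarrow> j \<in> M') \<and> (\<exists>j\<in>insert m M'. x = zs' ! j)"
    by (rule Suc.IH) (use Suc.prems zs sub in \<open>auto simp: M'_def\<close>)
  then obtain x xs k where x: "bubblesort_pass (x # xs) = zs'"
    "\<And>j. Suc j \<in> lr_maxima (x # xs) \<longleftrightarrow> j \<in> M'" "k \<in> insert m M'" "x = zs' ! k"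
    by blast
  \<comment> \<open>\<open>x\<close> sits at a chosen position of \<open>zs'\<close>, hence is a
    left-to-right maximum of \<open>zs\<close> and exceeds the first entry.\<close>
  have zx: "z < x" using sub(2)[OF x(3)] x(4) by simp
  show ?case
  proof (cases "0 \<in> M")
    case True
    \<comment> \<open>A chosen first entry stays in front, as a block of its own.\<close>
    have "bubblesort_pass (z # x # xs) = zs" using zx x zs by auto
    moreover have "Suc j \<in> lr_maxima (z # x # xs) \<longleftrightarrow> j \<in> M" for j
      using True zx x(2) by (cases j) (auto simp: lr_maxima_less zero_in_lr_maxima_iff M'_def)
    moreover have "z = zs ! 0" using zs by simp
    ultimately show ?thesis using True by blast
  next
    case False
    \<comment> \<open>An unchosen \<open>z\<close> goes behind \<open>x\<close>, so that the scan
      carries \<open>x\<close> past it.\<close>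
    have "bubblesort_pass (x # z # xs) = zs" using zx x zs by auto
    moreover have "Suc j \<in> lr_maxima (x # z # xs) \<longleftrightarrow> j \<in> M" for j
      using False zx x(2) by (cases j) (auto simp: lr_maxima_greater M'_def)
    moreover have "x = zs ! Suc k" "Suc k \<in> insert (Suc m) M" using zs x by (auto simp: M'_def)
    ultimately show ?thesis by blast
  qed
qed

lemma length_S: "xs \<in> S n \<Longrightarrow> length xs = n"
  using length_finite_permutations_of_set by fastforce

text \<open>\<open>u\<close> prescribes the left-to-right maxima of the preimage. Both conditions on
  \<open>lr_maxima zs\<close> are also necessary, by
  \<open>lr_maxima_bubblesort_pass\<close>.\<close>

lemma bubblesort_pass_preimage_in_S:
  assumes "zs \<in> S n" "u \<in> S n" "n > 0" "n - 1 \<in> lr_maxima zs"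
    and "\<And>j. Suc j \<in> lr_maxima u \<Longrightarrow> j \<in> lr_maxima zs"
  obtains v where "v \<in> S n" "bubblesort_pass v = zs" "lr_maxima v = lr_maxima u"
proof -
  obtain m where m: "n = Suc m" using assms(3) by (cases n) auto
  have len: "length zs = Suc m" "length u = Suc m"
    using assms(1,2) m length_S by blast+
  define M where "M = {j. Suc j \<in> lr_maxima u}"
  have "\<exists>x xs. bubblesort_pass (x # xs) = zs \<and>
    (\<forall>j. Suc j \<in> lr_maxima (x # xs) \<longleftrightarrow> j \<in> M) \<and> (\<exists>j\<in>insert m M. x = zs ! j)"
    by (rule bubblesort_pass_preimage_exists)
      (use assms m len in \<open>auto simp: M_def lr_maxima_def permutations_of_set_def\<close>)
  then obtain x xs where v: "bubblesort_pass (x # xs) = zs"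
    "\<And>j. Suc j \<in> lr_maxima (x # xs) \<longleftrightarrow> j \<in> M" by blast
  have "j \<in> lr_maxima (x # xs) \<longleftrightarrow> j \<in> lr_maxima u" for j
    using v(2) len by (cases j) (auto simp: zero_in_lr_maxima_iff M_def)
  then have "lr_maxima (x # xs) = lr_maxima u" by blast
  moreover have "x # xs \<in> S n"
    using v(1) assms(1) bubblesort_pass_in_S_iff by metis
  ultimately show ?thesis using that v(1) by blast
qed

section \<open>The bubblesort tree\<close>

lemma id_perm_in_S: "id_perm n \<in> S n"
  by (auto simp: id_perm_def permutations_of_set_def)

lemma lr_maxima_eq_iff_id_perm:
  assumes "xs \<in> S n"
  shows "lr_maxima xs = {..<n} \<longleftrightarrow> xs = id_perm n"
proof
  assume "lr_maxima xs = {..<n}"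
  then have "xs ! i < xs ! j" if "i < j" "j < n" for i j
    using that unfolding lr_maxima_def by blast
  then have "sorted_wrt (<) xs"
    using length_S[OF assms] by (simp add: sorted_wrt_iff_nth_less)
  then have "sorted xs" by (simp add: strict_sorted_iff)
  moreover have "sorted (id_perm n)" by (simp add: id_perm_def del: upt_Suc)
  ultimately show "xs = id_perm n"
    using permutations_of_setD[OF assms] permutations_of_setD[OF id_perm_in_S[of n]]
    by (simp add: sorted_distinct_set_unique)
qed (auto simp: lr_maxima_def id_perm_def simp del: upt_Suc)

lemma bubblesort_pass_sorted: "sorted xs \<Longrightarrow> bubblesort_pass xs = xs"
  by (induction xs rule: bubblesort_pass.induct) auto

lemma bubblesort_pass_id_perm: "bubblesort_pass (id_perm n) = id_perm n"
  by (simp add: id_perm_def bubblesort_pass_sorted del: upt_Suc)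

text \<open>Each pass shifts the final run of left-to-right maxima one place to the left and adds
  the last position, so \<open>n\<close> passes reach the identity.\<close>

lemma lr_maxima_funpow_bubblesort_pass:
  assumes "xs \<in> S n"
  shows "(bubblesort_pass ^^ d) xs \<in> S n \<and> {n - d..<n} \<subseteq> lr_maxima ((bubblesort_pass ^^ d) xs)"
proof (induction d)
  case (Suc d)
  let ?ys = "(bubblesort_pass ^^ d) xs"
  have ys: "distinct ?ys" "length ?ys = n"
    using Suc length_S[of ?ys n] permutations_of_setD(2) by blast+
  have "j \<in> lr_maxima (bubblesort_pass ?ys)" if "j \<in> {n - Suc d..<n}" for j
  proof (rule lr_maxima_bubblesort_pass)
    have "Suc j = n \<or> Suc j \<in> {n - d..<n}" using that by auto
    then show "Suc j = length ?ys \<or> Suc j \<in> lr_maxima ?ys" using Suc ys by auto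
  qed (use ys in simp)
  then show ?case using Suc bubblesort_pass_in_S_iff by auto
qed (use assms in simp)

interpretation bubblesort: labelled_parent_map "S n" bubblesort_pass "id_perm n" lr_maxima for n
proof
  show "bubblesort_pass z \<in> S n" if "z \<in> S n" for z
    using that bubblesort_pass_in_S_iff by blast
  show "bubblesort_pass (id_perm n) = id_perm n" by (rule bubblesort_pass_id_perm)
  show "\<exists>d. (bubblesort_pass ^^ d) z = id_perm n" if "z \<in> S n" for z
  proof -
    let ?w = "(bubblesort_pass ^^ n) z"
    have w: "?w \<in> S n" "{..<n} \<subseteq> lr_maxima ?w"
      using lr_maxima_funpow_bubblesort_pass[OF that, of n] by (auto simp: lessThan_atLeast0)
    moreover have "lr_maxima ?w \<subseteq> {..<n}" using length_S[OF w(1)] by (auto simp: lr_maxima_def)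
    ultimately show ?thesis using lr_maxima_eq_iff_id_perm by blast
  qed
  show "\<exists>!v. v \<in> S n \<and> bubblesort_pass v = y \<and> lr_maxima v = lr_maxima u"
    if *: "x \<in> S n" "y \<in> S n" "x \<noteq> id_perm n" "y \<noteq> id_perm n" "lr_maxima x = lr_maxima y"
      "u \<in> S n" "bubblesort_pass u = x" for x y u
  proof (rule ex_ex1I)
    have "n > 0" using * by (cases n) (auto simp: id_perm_def)
    have u: "distinct u" "length u = n"
      using * length_S[of u n] permutations_of_setD(2) by blast+
    \<comment> \<open>The conditions on \<open>y\<close> hold for \<open>x\<close>, the image of
      \<open>u\<close>, and carry over because they involve only left-to-right maxima.\<close>
    obtain v where "v \<in> S n" "bubblesort_pass v = y" "lr_maxima v = lr_maxima u"
      by (rule bubblesort_pass_preimage_in_S[of y n u])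
        (use * u \<open>n > 0\<close> lr_maxima_bubblesort_pass[of u] in auto)
    then show "\<exists>v. v \<in> S n \<and> bubblesort_pass v = y \<and> lr_maxima v = lr_maxima u" by blast
  next
    fix v w
    assume "v \<in> S n \<and> bubblesort_pass v = y \<and> lr_maxima v = lr_maxima u"
      and "w \<in> S n \<and> bubblesort_pass w = y \<and> lr_maxima w = lr_maxima u"
    then show "v = w" by (metis bubblesort_pass_eqD permutations_of_setD(2))
  qed
qed

theorem proposition3p4:
  fixes n :: nat and \<pi> :: "nat list"
  assumes "\<pi> \<in> S n" and "\<pi> \<noteq> id_perm n"
  shows "\<exists>\<tau>. is_child (bubblesort_tree n) \<tau> (id_perm n) \<and>
           rooted_tree_isomorphic (subtree (bubblesort_tree n) \<pi>) (subtree (bubblesort_tree n) \<tau>)"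
proof -
  have n: "n > 0" using assms by (cases n) (auto simp: id_perm_def)
  have id: "lr_maxima (id_perm n) = {..<n}"
    using lr_maxima_eq_iff_id_perm id_perm_in_S by blast
  \<comment> \<open>All positions of the identity are left-to-right maxima, so those of
    \<open>\<pi>\<close> can be prescribed.\<close>
  obtain \<tau> where \<tau>: "\<tau> \<in> S n" "bubblesort_pass \<tau> = id_perm n" "lr_maxima \<tau> = lr_maxima \<pi>"
    by (rule bubblesort_pass_preimage_in_S[OF id_perm_in_S assms(1) n])
      (use id n length_S[OF assms(1)] in \<open>auto simp: lr_maxima_def\<close>)
  \<comment> \<open>Otherwise all positions of \<open>\<pi>\<close> would be left-to-right maxima,
    forcing \<open>\<pi>\<close> to be the identity.\<close>
  have ne: "\<tau> \<noteq> id_perm n"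
    using \<tau> assms lr_maxima_eq_iff_id_perm by metis
  have tree: "bubblesort_tree n = bubblesort.tree n"
    by (simp only: bubblesort_tree_def bubblesort.tree_def)
  have "is_child (bubblesort_tree n) \<tau> (id_perm n)"
    using \<tau> ne id_perm_in_S by (auto simp: is_child_def bubblesort_tree_def)
  moreover have "rooted_tree_isomorphic (subtree (bubblesort_tree n) \<pi>) (subtree (bubblesort_tree n) \<tau>)"
    unfolding tree using assms \<tau> ne by (intro bubblesort.subtrees_isomorphic) auto
  ultimately show ?thesis by blast
qed

end
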